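(* For $n\geqslant 4$ let $\mathcal A$ be a maximal $\{2,4\}$-antichain of minimum size on $n$ points (i.e. of smallest cardinality among all maximal $\{2,4\}$-antichains in $2^{[n]}$). Then \[\left(\frac{219-4\sqrt{21}}{750}+o(1)\right)n^2\leqslant\lvert\mathcal A\rvert\leqslant\begin{cases}\left\lceil (5n^2-16n)/16\right\rceil & \text{if $n$ is even,}\\ \left\lfloor(5n^2-14n)/16\right\rfloor & \text{if $n$ is odd,}\end{cases}\] where $o(1)$ depends only on $n$ and tends to $0$ as $n\to\infty$.
   Context: Let $[n]=\{1,\dots,n\}$. A family $\mathcal A\subseteq 2^{[n]}$ is an antichain if $A\not\subseteq B$ for all distinct $A,B\in\mathcal A$. It is a $\{2,4\}$-antichain if moreover $|A|\in \{2,4\}$ for all $A\in\mathcal A$. A $\{2,4\}$-antichain $\mathcal A$ is a maximal $\{2,4\}$-antichain if there is no $\{2,4\}$-antichain $\mathcal A'\subseteq 2^{[n]}$ with $\mathcal A\subsetneq\mathcal A'$. *)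

theory Defs
  imports Complex_Main
begin

definition antichain_on :: "nat \<Rightarrow> nat set set \<Rightarrow> bool" where
  "antichain_on n \<A> \<longleftrightarrow>
     \<A> \<subseteq> Pow {1..n} \<and> (\<forall>A\<in>\<A>. \<forall>B\<in>\<A>. A \<noteq> B \<longrightarrow> \<not> A \<subseteq> B)"

definition antichain24 :: "nat \<Rightarrow> nat set set \<Rightarrow> bool" where
  "antichain24 n \<A> \<longleftrightarrow> antichain_on n \<A> \<and> (\<forall>A\<in>\<A>. card A \<in> {2, 4})"

definition maximal_antichain24 :: "nat \<Rightarrow> nat set set \<Rightarrow> bool" where
  "maximal_antichain24 n \<A> \<longleftrightarrow>
     antichain24 n \<A> \<and> \<not> (\<exists>\<A>'. antichain24 n \<A>' \<and> \<A> \<subset> \<A>')"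

definition minimum_maximal_antichain24 :: "nat \<Rightarrow> nat set set \<Rightarrow> bool" where
  "minimum_maximal_antichain24 n \<A> \<longleftrightarrow> is_arg_min card (maximal_antichain24 n) \<A>"

end

theory Submission
  imports Defs
begin

text \<open>
  The pairs outside a maximal \<open>{2,4}\<close>-antichain form a graph in which every edge lies in a
  \<open>K\<^sub>4\<close>, and the 4-sets of the antichain are exactly the 4-cliques; so the size is
  \<open>n(n-1)/2 - e + k\<close> with \<open>e\<close> edges and \<open>k\<close> 4-cliques.

  Lower bound. We may assume \<open>k \<le> e\<close>, so there are few 4-cliques and hence, with codegrees scaled
  by \<open>n\<close>, the sum of \<open>codeg f - 1/3\<close> over all edges is \<open>O(1)\<close> (the Moon-Moser argument). Give an
  edge \<open>f = uv\<close> the cost \<open>0.232 (1/d\<^sub>u + 1/d\<^sub>v) + (codeg f - 1/3)/3\<close>, where \<open>d\<close> is the degree divided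
  by \<open>n\<close>. The total cost is at most \<open>0.232 n\<^sup>2 + O(1)\<close>. Assign each edge to one 4-clique
  containing it. A clique that receives \<open>w\<close> edges receives cost at least \<open>w - 1\<close>: every single
  edge costs at least 2/3, which settles \<open>w \<le> 3\<close>; and if \<open>w \<ge> 4\<close> after discarding the \<open>O(n)\<close> edges
  in triangles that lie in linearly many 4-cliques, then the four degrees sum to at most about
  \<open>2n\<close>, which makes the reciprocals large. Hence \<open>e - k \<le> 0.232 n\<^sup>2 + O(n)\<close>, and
  \<open>1/2 - 0.232 = 0.268\<close> exceeds the constant \<open>0.26756\<close> of the theorem.

  Upper bound. Join two nearly equal vertex sets completely and put a perfect matching (with one
  path on three vertices if the size is odd) inside each.
\<close>

section \<open>Graphs with few 4-cliques\<close>

text \<open>Expand \<open>0 <= (s - k * x)^2\<close> and divide by \<open>x\<close>. The bound is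
  linear in \<open>x\<close>, so it can be summed when only the sum of the \<open>x\<close> is
  controlled; it is sharpest at \<open>k = s / x\<close>.\<close>

lemma amgm_tangent:
  fixes r s x k :: real
  assumes "0 < x" "s\<^sup>2 \<le> r"
  shows "2 * k * s - k\<^sup>2 * x \<le> r / x"
proof -
  have "0 \<le> (r - s\<^sup>2) + (s - k * x)\<^sup>2" using assms by simp
  then have "(2 * k * s - k\<^sup>2 * x) * x \<le> r" by (simp add: power2_eq_square algebra_simps)
  then show ?thesis using assms by (simp add: pos_le_divide_eq)
qed

lemma card_pairs:
  assumes "card K = m" "finite K"
  shows "card {f. f \<subseteq> K \<and> card f = 2} = m choose 2"
  using n_subsets[of K 2] assms by simp

locale finite_graph =
  fixes V :: "'a set" and E :: "'a set set"
  assumes finite_V: "finite V" and edges: "E \<subseteq> {f. f \<subseteq> V \<and> card f = 2}"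
begin

text \<open>Neighbourhoods of vertices and common neighbourhoods of pairs and triples in one
  notion.\<close>

definition common :: "'a set \<Rightarrow> 'a set" where
  "common S = {w \<in> V. \<forall>u\<in>S. {u, w} \<in> E}"

definition cliques4 :: "'a set set" where
  "cliques4 = {K. K \<subseteq> V \<and> card K = 4 \<and> (\<forall>f. f \<subseteq> K \<and> card f = 2 \<longrightarrow> f \<in> E)}"

definition adj :: "'a \<Rightarrow> 'a \<Rightarrow> real" where
  "adj x y = of_bool ({x, y} \<in> E)"

text \<open>Counts each 4-clique 24 times. The factors are grouped as a triangle
  \<open>x y z\<close> and its extension by a fourth vertex \<open>w\<close>.\<close>

definition ordered_cliques4 :: real where
  "ordered_cliques4 = (\<Sum>x\<in>V. \<Sum>y\<in>V. \<Sum>z\<in>V. \<Sum>w\<in>V.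
     adj x y * adj x z * adj y z * (adj x w * adj y w * adj z w))"

lemma finite_E: "finite E"
  using edges finite_V by (auto intro: finite_subset[of E "Pow V"])

lemma edgeD: "{x, y} \<in> E \<Longrightarrow> x \<in> V \<and> y \<in> V \<and> x \<noteq> y"
  using edges by fastforce

lemma edgeE:
  assumes "f \<in> E"
  obtains u v where "f = {u, v}" "u \<noteq> v" "u \<in> V" "v \<in> V"
proof -
  have "card f = 2" "f \<subseteq> V" using assms edges by auto
  then show ?thesis using that by (auto simp: card_2_iff)
qed

lemma finite_common: "finite (common S)"
  using finite_V by (auto simp: common_def)

lemma finite_cliques4: "finite cliques4"
  using finite_V by (auto simp: cliques4_def intro: finite_subset[of _ "Pow V"])

lemma adj_commute: "adj x y = adj y x"
  by (simp add: adj_def insert_commute)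

lemma adj_cases: "adj x y = 0 \<or> adj x y = 1"
  by (simp add: adj_def)

lemma card_common: "real (card (common S)) = (\<Sum>w\<in>V. of_bool (\<forall>u\<in>S. {u, w} \<in> E))"
proof -
  have "common S = V \<inter> {w. \<forall>u\<in>S. {u, w} \<in> E}" by (auto simp: common_def)
  then show ?thesis using finite_V by (simp add: of_bool_def sum.If_cases)
qed

lemma card_common_1: "real (card (common {x})) = (\<Sum>w\<in>V. adj x w)"
  unfolding card_common by (intro sum.cong) (auto simp: adj_def)

lemma card_common_2: "real (card (common {x, y})) = (\<Sum>w\<in>V. adj x w * adj y w)"
  unfolding card_common by (intro sum.cong) (auto simp: adj_def)

lemma card_common_3:
  "real (card (common {x, y, z})) = (\<Sum>w\<in>V. adj x w * adj y w * adj z w)"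
  unfolding card_common by (intro sum.cong) (auto simp: adj_def)

lemma bij_betw_common_edges: "bij_betw (\<lambda>y. {x, y}) (common {x}) {f \<in> E. x \<in> f}"
proof (rule bij_betwI')
  fix y y' assume "y \<in> common {x}" "y' \<in> common {x}"
  then show "({x, y} = {x, y'}) = (y = y')" by (auto simp: doubleton_eq_iff)
next
  fix f assume "f \<in> {f \<in> E. x \<in> f}"
  then have f: "f \<in> E" "x \<in> f" by auto
  from f(1) obtain u v where "f = {u, v}" "u \<in> V" "v \<in> V" by (rule edgeE)
  then have "\<exists>y\<in>V. f = {x, y}" using f(2) by (auto simp: insert_commute)
  then show "\<exists>y\<in>common {x}. f = {x, y}" using f(1) by (auto simp: common_def)
qed (auto simp: common_def)

text \<open>Double counting of incident vertex-edge pairs.\<close>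

lemma sum_over_edge_ends:
  fixes F :: "'a \<Rightarrow> 'a set \<Rightarrow> real"
  shows "(\<Sum>f\<in>E. \<Sum>x\<in>f. F x f) = (\<Sum>x\<in>V. \<Sum>y\<in>common {x}. F x {x, y})"
proof -
  have "(\<Sum>f\<in>E. \<Sum>x\<in>f. F x f) = (\<Sum>f\<in>E. \<Sum>x\<in>{x \<in> V. x \<in> f}. F x f)"
    using edges by (intro sum.cong) auto
  also have "\<dots> = (\<Sum>x\<in>V. \<Sum>f\<in>{f \<in> E. x \<in> f}. F x f)"
    by (rule sum.swap_restrict[OF finite_E finite_V])
  also have "\<dots> = (\<Sum>x\<in>V. \<Sum>y\<in>common {x}. F x {x, y})"
    by (intro sum.cong refl sum.reindex_bij_betw[symmetric] bij_betw_common_edges)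
  finally show ?thesis .
qed

lemma sum_ordered_edges:
  fixes F :: "'a set \<Rightarrow> real"
  shows "(\<Sum>x\<in>V. \<Sum>y\<in>V. adj x y * F {x, y}) = 2 * (\<Sum>f\<in>E. F f)"
proof -
  have "(\<Sum>y\<in>V. adj x y * F {x, y}) = (\<Sum>y\<in>common {x}. F {x, y})" for x
    using finite_V by (intro sum.mono_neutral_cong_right) (auto simp: common_def adj_def)
  moreover have "(\<Sum>f\<in>E. \<Sum>x\<in>f. F f) = 2 * (\<Sum>f\<in>E. F f)"
    unfolding sum_distrib_left using edges by (intro sum.cong) auto
  ultimately show ?thesis using sum_over_edge_ends[of "\<lambda>x. F"] by simp
qed

text \<open>Every ordered clique is a 4-tuple over its own vertex set \<open>K\<close>, and there
  are \<open>4^4\<close> such tuples. This crude factor suffices, since only the order of magnitude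
  matters later.\<close>

lemma ordered_cliques4_le: "ordered_cliques4 \<le> 256 * card cliques4"
proof -
  define S where "S = {t \<in> V \<times> V \<times> V \<times> V. case t of (x, y, z, w) \<Rightarrow>
     {x,y} \<in> E \<and> {x,z} \<in> E \<and> {y,z} \<in> E \<and> {x,w} \<in> E \<and> {y,w} \<in> E \<and> {z,w} \<in> E}"
  have finS: "finite S" using finite_V by (auto simp: S_def)
  have "ordered_cliques4 = (\<Sum>t\<in>V \<times> V \<times> V \<times> V. of_bool (t \<in> S))"
    unfolding ordered_cliques4_def sum.cartesian_product
    by (intro sum.cong refl) (auto simp: S_def adj_def)
  also have "\<dots> = real (card S)"
    using finite_V by (simp add: of_bool_def sum.If_cases)
      (intro arg_cong[of _ _ card], auto simp: S_def)
  also have "card S \<le> card (\<Union>K\<in>cliques4. K \<times> K \<times> K \<times> K)"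
  proof (rule card_mono)
    show "finite (\<Union>K\<in>cliques4. K \<times> K \<times> K \<times> K)"
      using finite_cliques4 finite_V by (auto simp: cliques4_def intro!: finite_cartesian_product
          intro: finite_subset)
    show "S \<subseteq> (\<Union>K\<in>cliques4. K \<times> K \<times> K \<times> K)"
    proof
      fix t assume "t \<in> S"
      then obtain x y z w where t: "t = (x, y, z, w)" and
        e: "{x,y} \<in> E" "{x,z} \<in> E" "{y,z} \<in> E" "{x,w} \<in> E" "{y,w} \<in> E" "{z,w} \<in> E"
        by (auto simp: S_def)
      note d = e[THEN edgeD]
      have "{x, y, z, w} \<in> cliques4"
        unfolding cliques4_def
      proof (intro CollectI conjI allI impI)
        show "{x, y, z, w} \<subseteq> V" "card {x, y, z, w} = 4" using d by auto
        fix f assume f: "f \<subseteq> {x, y, z, w} \<and> card f = 2"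
        then obtain p q where "f = {p, q}" "p \<noteq> q" by (auto simp: card_2_iff)
        with f e show "f \<in> E" by (auto simp: insert_commute)
      qed
      then show "t \<in> (\<Union>K\<in>cliques4. K \<times> K \<times> K \<times> K)" using t by blast
    qed
  qed
  also have "\<dots> \<le> (\<Sum>K\<in>cliques4. card (K \<times> K \<times> K \<times> K))"
    by (rule card_UN_le[OF finite_cliques4])
  also have "\<dots> = 256 * card cliques4"
    by (simp add: cliques4_def card_cartesian_product)
  finally show ?thesis by simp
qed

text \<open>The Moon-Moser argument: counting how a fourth vertex attaches to a triangle bounds the
  sum of squared codegrees from above, and expanding a square around \<open>n/3\<close>, the
  codegree in the balanced complete tripartite graph, bounds it from below.\<close>

lemma sum_codegree_le:
  assumes "V \<noteq> {}"
  shows "(\<Sum>f\<in>E. real (card (common f)) / card V - 1/3) \<le> ordered_cliques4 / (card V)\<^sup>2"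
proof -
  define n where "n = real (card V)"
  have n: "n > 0" using assms finite_V by (simp add: n_def card_gt_0_iff)
  define cd where "cd x y = real (card (common {x, y}))" for x y
  define t where "t x y z = adj x y * adj x z * adj y z" for x y z
  define T1 where "T1 = (\<Sum>x\<in>V. \<Sum>y\<in>V. adj x y * cd x y)"
  define T2 where "T2 = (\<Sum>x\<in>V. \<Sum>y\<in>V. adj x y * (cd x y)\<^sup>2)"
  have T2a: "T2 = (\<Sum>x\<in>V. \<Sum>y\<in>V. \<Sum>z\<in>V. \<Sum>w\<in>V. t x y z * (adj x w * adj y w))"
    unfolding T2_def cd_def card_common_2 power2_eq_square
    by (simp only: t_def sum_product) (simp add: sum_distrib_left mult_ac)
  have t1: "t x y z = t x z y" "t x y z = t y x z" for x y z
    by (simp_all add: t_def adj_commute mult_ac)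
  \<comment> \<open>\<open>T2\<close> counts triangles with a vertex \<open>w\<close> joined to two
    chosen corners; by symmetry any two corners may be chosen.\<close>
  have T2b: "T2 = (\<Sum>x\<in>V. \<Sum>y\<in>V. \<Sum>z\<in>V. \<Sum>w\<in>V. t x y z * (adj x w * adj z w))"
    unfolding T2a
    by (rule sum.cong[OF refl], rule trans[OF sum.swap], intro sum.cong refl) (simp add: t1(1))
  have T2c: "T2 = (\<Sum>x\<in>V. \<Sum>y\<in>V. \<Sum>z\<in>V. \<Sum>w\<in>V. t x y z * (adj y w * adj z w))"
    unfolding T2b
    by (rule trans[OF sum.swap], intro sum.cong refl) (metis t1(2))
  have nT1: "n * T1 = (\<Sum>x\<in>V. \<Sum>y\<in>V. \<Sum>z\<in>V. \<Sum>w\<in>V. t x y z)"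
    unfolding T1_def cd_def card_common_2 n_def t_def
    by (simp add: sum_distrib_left mult_ac)
  \<comment> \<open>If \<open>w\<close> has \<open>j\<close> neighbours in the triangle, this says
    \<open>j choose 2 <= 1 + 2 * [j = 3]\<close>.\<close>
  have pw: "t x y z * (adj x w * adj y w) + t x y z * (adj x w * adj z w) + t x y z * (adj y w * adj z w)
      \<le> t x y z + 2 * (t x y z * (adj x w * adj y w * adj z w))" for x y z w
    using adj_cases[of x w] adj_cases[of y w] adj_cases[of z w] adj_cases[of x y]
      adj_cases[of x z] adj_cases[of y z] unfolding t_def by auto
  have "3 * T2 = T2 + T2 + T2" by simp
  also have "\<dots> = (\<Sum>x\<in>V. \<Sum>y\<in>V. \<Sum>z\<in>V. \<Sum>w\<in>V. t x y z * (adj x w * adj y w)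
      + t x y z * (adj x w * adj z w) + t x y z * (adj y w * adj z w))"
    by (simp only: sum.distrib T2a[symmetric] T2b[symmetric] T2c[symmetric])
  also have "\<dots> \<le> (\<Sum>x\<in>V. \<Sum>y\<in>V. \<Sum>z\<in>V. \<Sum>w\<in>V.
      t x y z + 2 * (t x y z * (adj x w * adj y w * adj z w)))"
    by (intro sum_mono pw)
  also have "\<dots> = n * T1 + 2 * ordered_cliques4"
    unfolding nT1 ordered_cliques4_def by (simp add: sum.distrib sum_distrib_left t_def)
  finally have A: "3 * T2 \<le> n * T1 + 2 * ordered_cliques4" .
  have "0 \<le> (\<Sum>x\<in>V. \<Sum>y\<in>V. adj x y * (cd x y - n/3)\<^sup>2)"
    by (intro sum_nonneg) (simp add: adj_def)
  also have "\<dots> = (\<Sum>x\<in>V. \<Sum>y\<in>V. adj x y * (cd x y)\<^sup>2 - (2*n/3) * (adj x y * cd x y)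
      + n\<^sup>2/9 * adj x y)"
    by (intro sum.cong refl) (simp add: power2_eq_square algebra_simps)
  also have "\<dots> = T2 - (2*n/3) * T1 + n\<^sup>2/9 * (\<Sum>x\<in>V. \<Sum>y\<in>V. adj x y)"
    by (simp add: T1_def T2_def sum.distrib sum_subtractf sum_distrib_left)
  also have "(\<Sum>x\<in>V. \<Sum>y\<in>V. adj x y) = 2 * card E"
    using sum_ordered_edges[of "\<lambda>_. 1"] by simp
  finally have B: "0 \<le> T2 - (2*n/3) * T1 + n\<^sup>2/9 * (2 * card E)" .
  have T1e: "T1 = 2 * (\<Sum>f\<in>E. real (card (common f)))"
    unfolding T1_def cd_def by (rule sum_ordered_edges)
  have "n * T1 - n\<^sup>2/3 * (2 * card E) \<le> 2 * ordered_cliques4"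
    using A B by (simp add: algebra_simps)
  then have "n * (\<Sum>f\<in>E. real (card (common f))) - n\<^sup>2/3 * card E \<le> ordered_cliques4"
    unfolding T1e by (simp add: algebra_simps)
  then have "(n * (\<Sum>f\<in>E. real (card (common f))) - n\<^sup>2/3 * card E) / n\<^sup>2 \<le> ordered_cliques4 / n\<^sup>2"
    by (simp add: divide_right_mono)
  moreover have "(n * (\<Sum>f\<in>E. real (card (common f))) - n\<^sup>2/3 * card E) / n\<^sup>2
     = (\<Sum>f\<in>E. real (card (common f)) / n - 1/3)"
    using n by (simp add: sum_subtractf sum_divide_distrib[symmetric] power2_eq_square field_simps)
      (simp add: sum_distrib_left)
  ultimately show ?thesis by (simp add: n_def)
qed

subsection \<open>Distributing the edges over the cliques\<close>

definition heavy_edges :: "real \<Rightarrow> 'a set set" where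
  "heavy_edges \<delta> = {f. \<exists>x y z. f = {x, y} \<and> {x, y} \<in> E \<and> {x, z} \<in> E \<and> {y, z} \<in> E \<and>
     \<delta> * card V \<le> card (common {x, y, z})}"

lemma heavy_edgesI:
  fixes \<delta> :: real
  assumes "{x, y} \<in> E" "{x, z} \<in> E" "{y, z} \<in> E" "\<delta> * card V \<le> card (common {x, y, z})"
  shows "{x, y} \<in> heavy_edges \<delta>"
  using assms unfolding heavy_edges_def by blast

text \<open>Each heavy edge comes from an ordered triangle that extends to at least
  \<open>\<delta> * card V\<close> ordered 4-cliques. With \<open>O(n^2)\<close> cliques this leaves
  \<open>O(n)\<close> heavy edges.\<close>

lemma card_heavy_edges:
  fixes \<delta> :: real
  assumes "\<delta> > 0"
  shows "\<delta> * card V * card (heavy_edges \<delta>) \<le> ordered_cliques4"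
proof -
  define H where "H = {t \<in> V \<times> V \<times> V. case t of (x, y, z) \<Rightarrow>
     {x,y} \<in> E \<and> {x,z} \<in> E \<and> {y,z} \<in> E \<and> \<delta> * card V \<le> card (common {x, y, z})}"
  define T where "T = (\<lambda>(x, y, z). adj x y * adj x z * adj y z * card (common {x, y, z}))"
  have finH: "finite H" using finite_V by (auto simp: H_def)
  have "heavy_edges \<delta> \<subseteq> (\<lambda>(x, y, z). {x, y}) ` H"
  proof
    fix f assume "f \<in> heavy_edges \<delta>"
    then obtain x y z where *: "f = {x, y}" "{x, y} \<in> E" "{x, z} \<in> E" "{y, z} \<in> E"
      "\<delta> * card V \<le> card (common {x, y, z})"
      unfolding heavy_edges_def by blast
    then have "(x, y, z) \<in> H" using edgeD[of x y] edgeD[of y z] by (simp add: H_def)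
    then show "f \<in> (\<lambda>(x, y, z). {x, y}) ` H" using *(1) by force
  qed
  then have "card (heavy_edges \<delta>) \<le> card H" using surj_card_le[OF finH] by simp
  then have "\<delta> * card V * card (heavy_edges \<delta>) \<le> \<delta> * card V * card H"
    using assms by (intro mult_left_mono) auto
  also have "\<dots> = (\<Sum>t\<in>H. \<delta> * card V)" by simp
  also have "\<dots> \<le> (\<Sum>t\<in>H. T t)"
    by (intro sum_mono) (auto simp: H_def T_def adj_def)
  also have "\<dots> \<le> (\<Sum>t\<in>V \<times> V \<times> V. T t)"
    using finite_V by (intro sum_mono2) (auto simp: H_def T_def adj_def)
  also have "\<dots> = ordered_cliques4"
    unfolding ordered_cliques4_def T_def card_common_3 sum.cartesian_product[symmetric]
      sum_distrib_left ..
  finally show ?thesis .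
qed

lemma codegree_ge:
  "real (card (common {u})) + card (common {v}) - card V \<le> card (common {u, v})"
proof -
  have "real (card (common {u})) + card (common {v}) - card V
      = (\<Sum>w\<in>V. adj u w + adj v w - 1)"
    by (simp add: card_common_1 sum.distrib sum_subtractf)
  also have "\<dots> \<le> (\<Sum>w\<in>V. adj u w * adj v w)"
    by (intro sum_mono) (auto simp: adj_def)
  finally show ?thesis by (simp add: card_common_2)
qed

text \<open>A vertex with \<open>j\<close> neighbours among four given vertices is counted \<open>j\<close> times by the degrees,
  \<open>j choose 2\<close> times by the codegrees of pairs and \<open>j choose 3\<close> times by those of triples.\<close>

lemma sum_degrees_le:
  "real (card (common {a})) + card (common {b}) + card (common {c}) + card (common {d})
   \<le> 2 * real (card V) + card (common {a, b, c}) + card (common {a, b, d})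
      + card (common {a, c, d}) + card (common {b, c, d})"
proof -
  \<comment> \<open>Pointwise \<open>j <= 2 + (j choose 3)\<close> for
    \<open>j <= 4\<close>.\<close>
  have "(\<Sum>w\<in>V. adj a w + adj b w + adj c w + adj d w) \<le> (\<Sum>w\<in>V. 2 + adj a w * adj b w * adj c w
      + adj a w * adj b w * adj d w + adj a w * adj c w * adj d w + adj b w * adj c w * adj d w)"
    by (intro sum_mono) (auto simp: adj_def)
  then show ?thesis by (simp add: card_common_1 card_common_3 sum.distrib)
qed

text \<open>Pointwise \<open>j - 1 <= j choose 2\<close>.\<close>

lemma sum_codegrees_ge:
  "real (card (common {a})) + card (common {b}) + card (common {c}) + card (common {d}) - card V
   \<le> real (card (common {a, b})) + card (common {a, c}) + card (common {a, d})
      + card (common {b, c}) + card (common {b, d}) + card (common {c, d})"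
proof -
  have "(\<Sum>w\<in>V. adj a w + adj b w + adj c w + adj d w - 1) \<le> (\<Sum>w\<in>V. adj a w * adj b w
      + adj a w * adj c w + adj a w * adj d w + adj b w * adj c w + adj b w * adj d w
      + adj c w * adj d w)"
    by (intro sum_mono) (auto simp: adj_def)
  then show ?thesis by (simp add: card_common_1 card_common_2 sum.distrib sum_subtractf)
qed

section \<open>Scaled degrees and the cost of an edge\<close>

definition deg :: "'a \<Rightarrow> real" where
  "deg u = card (common {u}) / card V"

definition codeg :: "'a set \<Rightarrow> real" where
  "codeg f = card (common f) / card V"

text \<open>Over all edges the reciprocal degrees sum to at most \<open>n^2\<close>, since a vertex
  contributes its degree times \<open>1 / deg u\<close>. So \<open>29/125\<close> becomes the
  coefficient of \<open>n^2\<close> in the bound on edges minus cliques.\<close>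

definition cost :: "'a set \<Rightarrow> real" where
  "cost f = 29/125 * (\<Sum>u\<in>f. 1 / deg u) + (codeg f - 1/3) / 3"

lemma codeg_nonneg: "codeg f \<ge> 0"
  by (simp add: codeg_def)

lemma deg_pos:
  assumes "f \<in> E" "u \<in> f"
  shows "deg u > 0"
proof -
  have "f \<in> {f \<in> E. u \<in> f}" using assms by simp
  then have "common {u} \<noteq> {}"
    using bij_betw_imp_surj_on[OF bij_betw_common_edges[of u]] by force
  then have "card (common {u}) > 0" "card V > 0"
    using finite_common finite_V by (auto simp: card_gt_0_iff common_def)
  then show ?thesis by (simp add: deg_def)
qed

text \<open>By \<open>codegree_ge\<close>, \<open>codeg f >= deg u + deg v - 1\<close>, which
  separates the two ends; each end is then minimised on its own.\<close>

lemma cost_ge: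
  assumes "f \<in> E"
  shows "cost f \<ge> 2/3"
proof -
  obtain u v where f: "f = {u, v}" "u \<noteq> v" "u \<in> V" using assms by (rule edgeE)
  have n: "card V > 0" using f(3) finite_V by (auto simp: card_gt_0_iff)
  \<comment> \<open>The minimum is near \<open>x = 5/6\<close>; the square around \<open>5/6\<close>
    requires the constant \<open>25/108\<close>, just below \<open>29/125\<close>.\<close>
  have g: "29/125 * inverse x \<ge> 5/9 - x/3" if "x > 0" for x :: real
  proof -
    have "0 \<le> (x - 5/6)\<^sup>2" by simp
    then have "(5/9 - x/3) * x \<le> 29/125" by (simp add: power2_eq_square algebra_simps)
    then show ?thesis using that by (simp only: pos_le_divide_eq flip: divide_inverse)
  qed
  have "(real (card (common {u})) + card (common {v}) - card V) / card V \<le> codeg f"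
    unfolding codeg_def f(1) using codegree_ge[of u v] by (rule divide_right_mono) simp
  then have "deg u + deg v - 1 \<le> codeg f"
    using n by (simp add: deg_def add_divide_distrib diff_divide_distrib)
  moreover have "29/125 * inverse (deg u) \<ge> 5/9 - deg u/3" "29/125 * inverse (deg v) \<ge> 5/9 - deg v/3"
    using assms f by (intro g deg_pos[of f]; simp)+
  moreover have "cost f = 29/125 * inverse (deg u) + 29/125 * inverse (deg v) + codeg f / 3 - 1/9"
    using f by (simp add: cost_def inverse_eq_divide diff_divide_distrib)
  ultimately show ?thesis by linarith
qed

text \<open>For \<open>w <= 3\<close> edges, \<open>2 * w / 3 >= w - 1\<close>. With four or more,
  \<open>P\<close> meets every triangle of \<open>K\<close>, so no triangle is heavy and the degrees
  sum to little more than 2; the reciprocals are then large.\<close>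

lemma clique_sum_cost_ge:
  assumes K: "K \<in> cliques4" and P: "P \<subseteq> {f. f \<subseteq> K \<and> card f = 2}"
    and heavy: "P \<inter> heavy_edges (1/1000) = {}"
  shows "real (card P) - 1 \<le> sum cost P"
proof (cases "card P \<le> 3")
  case True
  have "P \<subseteq> E" using K P by (auto simp: cliques4_def)
  then have "(\<Sum>f\<in>P. 2/3) \<le> sum cost P" by (intro sum_mono cost_ge) auto
  then show ?thesis using True by simp
next
  case False
  let ?Q = "{f. f \<subseteq> K \<and> card f = 2}"
  have KV: "K \<subseteq> V" "card K = 4" and KE: "\<And>f. f \<in> ?Q \<Longrightarrow> f \<in> E"
    using K by (auto simp: cliques4_def)
  have finK: "finite K" using KV finite_V finite_subset by blast
  have n: "card V > 0" using KV finite_V by (auto simp: card_gt_0_iff)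
  have finQ: "finite ?Q" using finK by simp
  then have finP: "finite P" using P finite_subset by blast
  have cQ: "card ?Q = 6" using card_pairs[OF KV(2) finK] by (simp add: choose_two)
  have w6: "card P \<le> 6" using card_mono[OF finQ P] cQ by simp
  \<comment> \<open>A triangle with larger codegree would make three of the six pairs of
    \<open>K\<close> heavy, leaving at most three for \<open>P\<close>.\<close>
  have light: "codeg {x, y, z} \<le> 1/1000"
    if xyz: "x \<in> K" "y \<in> K" "z \<in> K" "x \<noteq> y" "x \<noteq> z" "y \<noteq> z" for x y z
  proof (rule ccontr)
    assume "\<not> ?thesis"
    then have h: "1/1000 * card V \<le> card (common {x, y, z})"
      using n by (simp add: codeg_def field_simps)
    define T where "T = {{x, y}, {x, z}, {y, z}}"
    have TQ: "T \<subseteq> ?Q" using xyz by (auto simp: T_def)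
    have e: "{x, y} \<in> E" "{x, z} \<in> E" "{y, z} \<in> E" using xyz by (auto intro: KE)
    have "{x, z, y} = {x, y, z}" "{y, z, x} = {x, y, z}" "{z, x} = {x, z}" "{z, y} = {y, z}"
      "{y, x} = {x, y}" by auto
    then have "{x, y} \<in> heavy_edges (1/1000)" "{x, z} \<in> heavy_edges (1/1000)"
      "{y, z} \<in> heavy_edges (1/1000)"
      using e h heavy_edgesI[of x y z "1/1000"] heavy_edgesI[of x z y "1/1000"]
        heavy_edgesI[of y z x "1/1000"] by metis+
    then have "T \<subseteq> heavy_edges (1/1000)" by (simp add: T_def)
    then have "P \<subseteq> ?Q - T" using P heavy by blast
    then have "card P \<le> card (?Q - T)" using finQ by (intro card_mono) auto
    also have "\<dots> = 3"
    proof -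
      have "card T = 3" using xyz by (simp add: T_def doubleton_eq_iff)
      then show ?thesis
        using card_Diff_subset[OF finite_subset[OF TQ finQ] TQ] cQ by simp
    qed
    finally show False using False by simp
  qed
  obtain a b c d where abcd: "K = {a, b, c, d}" "a \<noteq> b" "a \<noteq> c" "a \<noteq> d" "b \<noteq> c" "b \<noteq> d" "c \<noteq> d"
    using KV(2) by (auto simp: card_Suc_eq numeral_eq_Suc)
  define s where "s = sum deg K"
  have s: "s = deg a + deg b + deg c + deg d" using abcd by (simp add: s_def)
  have s_le: "s \<le> 2 + 4/1000"
  proof -
    have "s \<le> (2 * real (card V) + card (common {a, b, c}) + card (common {a, b, d})
      + card (common {a, c, d}) + card (common {b, c, d})) / card V"
      unfolding s deg_def add_divide_distrib[symmetric]
      by (intro divide_right_mono sum_degrees_le) simp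
    also have "\<dots> = 2 + codeg {a, b, c} + codeg {a, b, d} + codeg {a, c, d} + codeg {b, c, d}"
      using n by (simp add: codeg_def add_divide_distrib)
    also have "\<dots> \<le> 2 + 4/1000"
      using light[of a b c] light[of a b d] light[of a c d] light[of b c d] abcd by simp
    finally show ?thesis .
  qed
  have deg_K: "deg u > 0" if "u \<in> K" for u
  proof -
    obtain v where "v \<in> K" "v \<noteq> u" using abcd by blast
    then have "{u, v} \<in> E" using that by (intro KE) auto
    then show ?thesis using deg_pos by blast
  qed
  define r where "r u = card {f \<in> P. u \<in> f}" for u
  have swap: "(\<Sum>f\<in>P. \<Sum>u\<in>f. F u) = (\<Sum>u\<in>K. r u * F u)" for F :: "'a \<Rightarrow> real"
  proof -
    have "(\<Sum>f\<in>P. \<Sum>u\<in>f. F u) = (\<Sum>f\<in>P. \<Sum>u\<in>{u \<in> K. u \<in> f}. F u)"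
      using P by (intro sum.cong) auto
    also have "\<dots> = (\<Sum>u\<in>K. \<Sum>f\<in>{f \<in> P. u \<in> f}. F u)"
      by (rule sum.swap_restrict[OF finP finK])
    finally show ?thesis by (simp add: r_def)
  qed
  have sum_r: "(\<Sum>u\<in>K. real (r u)) = 2 * card P"
  proof -
    have "(\<Sum>f\<in>P. \<Sum>u\<in>f. 1::real) = (\<Sum>f\<in>P. 2)" using P by (intro sum.cong) auto
    then show ?thesis using swap[of "\<lambda>_. 1"] by simp
  qed
  \<comment> \<open>\<open>r u\<close> is the degree of \<open>u\<close> in the graph
    \<open>P\<close> on \<open>K\<close>; the edges of \<open>P\<close> avoiding \<open>u\<close>
    lie in the triangle \<open>K - {u}\<close>.\<close>
  have r_bounds: "card P \<le> r u + 3 \<and> r u \<le> 3" if "u \<in> K" for u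
  proof -
    have c3: "card {f. f \<subseteq> K - {u} \<and> card f = 2} = 3"
      using card_pairs[of "K - {u}" 3] KV(2) finK that by (simp add: choose_two)
    have "card P = card ({f \<in> P. u \<in> f} \<union> {f \<in> P. u \<notin> f})"
      by (intro arg_cong[of _ _ card]) auto
    also have "\<dots> = r u + card {f \<in> P. u \<notin> f}"
      unfolding r_def using finP by (intro card_Un_disjoint) auto
    also have "card {f \<in> P. u \<notin> f} \<le> card {f. f \<subseteq> K - {u} \<and> card f = 2}"
      using P finK by (intro card_mono) auto
    finally have 1: "card P \<le> r u + 3" using c3 by simp
    have "6 = card ({f \<in> ?Q. u \<in> f} \<union> {f. f \<subseteq> K - {u} \<and> card f = 2})"
      unfolding cQ[symmetric] by (intro arg_cong[of _ _ card]) auto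
    also have "\<dots> = card {f \<in> ?Q. u \<in> f} + card {f. f \<subseteq> K - {u} \<and> card f = 2}"
      using finK by (intro card_Un_disjoint) auto
    finally have "card {f \<in> ?Q. u \<in> f} = 3" using c3 by simp
    moreover have "r u \<le> card {f \<in> ?Q. u \<in> f}"
      unfolding r_def using P finK by (intro card_mono) auto
    ultimately show ?thesis using 1 by simp
  qed
  \<comment> \<open>\<open>p + q r\<close> plays the role of a chord of the square root, so this approximates
    \<open>\<Sum>r\<^sub>u/d\<^sub>u \<ge> (\<Sum>\<surd>r\<^sub>u)\<^sup>2 / s\<close>.\<close>
  have lower: "2 * k * (4 * p + 2 * q * card P) - k\<^sup>2 * s \<le> (\<Sum>f\<in>P. \<Sum>u\<in>f. 1 / deg u)"
    if sq: "\<And>u. u \<in> K \<Longrightarrow> (p + q * r u)\<^sup>2 \<le> r u" for p q k :: real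
  proof -
    have "2 * k * (4 * p + 2 * q * card P) - k\<^sup>2 * s
        = (\<Sum>u\<in>K. 2 * k * (p + q * r u) - k\<^sup>2 * deg u)"
    proof -
      have "(\<Sum>u\<in>K. p + q * r u) = 4 * p + q * (2 * card P)"
        using KV(2) sum_r by (simp add: sum.distrib flip: sum_distrib_left)
      then show ?thesis
        by (simp add: sum_subtractf s_def sum_distrib_left[symmetric])
    qed
    also have "\<dots> \<le> (\<Sum>u\<in>K. r u / deg u)"
      by (intro sum_mono amgm_tangent deg_K sq)
    also have "\<dots> = (\<Sum>f\<in>P. \<Sum>u\<in>f. 1 / deg u)"
      using swap[of "\<lambda>u. 1 / deg u"] by simp
    finally show ?thesis .
  qed
  have cost_sum: "sum cost P = 29/125 * (\<Sum>f\<in>P. \<Sum>u\<in>f. 1 / deg u) + (sum codeg P) / 3 - card P / 9"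
    unfolding cost_def
    by (simp add: sum.distrib sum_distrib_left sum_subtractf diff_divide_distrib sum_divide_distrib)
  have codeg_P: "sum codeg P \<ge> 0" by (intro sum_nonneg codeg_nonneg)
  consider "card P = 4" | "card P = 5" | "card P = 6" using False w6 by linarith
  then show ?thesis
  proof cases
    case 1
    \<comment> \<open>The chord of the square root from 1 to 3, rounded down. The multiplier
      \<open>k = 27/10\<close> is close to the optimal \<open>(4 * p + 2 * q * card P) / s\<close>
      at \<open>s = 2\<close>; the other cases choose \<open>k\<close> likewise.\<close>
    have "(634/1000 + 366/1000 * r u)\<^sup>2 \<le> real (r u)" if "u \<in> K" for u
    proof -
      have "r u = 1 \<or> r u = 2 \<or> r u = 3" using r_bounds[OF that] 1 by linarith
      then show ?thesis by (auto simp: power2_eq_square)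
    qed
    from lower[OF this, of "27/10"] show ?thesis
      using s_le cost_sum codeg_P 1 by (simp add: power2_eq_square)
  next
    case 2
    \<comment> \<open>The chord from 2 to 3, rounded down.\<close>
    have "(778/1000 + 318/1000 * r u)\<^sup>2 \<le> real (r u)" if "u \<in> K" for u
    proof -
      have "r u = 2 \<or> r u = 3" using r_bounds[OF that] 2 by linarith
      then show ?thesis by (auto simp: power2_eq_square)
    qed
    from lower[OF this, of "31/10"] show ?thesis
      using s_le cost_sum codeg_P 2 by (simp add: power2_eq_square)
  next
    case 3
    \<comment> \<open>Here every \<open>r u\<close> is 3, so a constant below the square root of 3
      serves. The reciprocals alone fall short of 5 when \<open>s\<close> is near 2; the codegrees,
      summing to at least \<open>s - 1\<close>, close the gap.\<close>
    have "(1732/1000 + 0 * real (r u))\<^sup>2 \<le> real (r u)" if "u \<in> K" for u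
      using r_bounds[OF that] 3 by (auto simp: power2_eq_square)
    note l = lower[OF this, of "34/10"]
    have "P = ?Q" using card_subset_eq[OF finQ P] 3 cQ by simp
    also have "?Q = {{a,b},{a,c},{a,d},{b,c},{b,d},{c,d}}" (is "_ = ?R")
    proof (rule card_subset_eq[OF finQ, symmetric])
      show "?R \<subseteq> ?Q" using abcd by auto
      show "card ?R = card ?Q" unfolding cQ using abcd by (auto simp: doubleton_eq_iff)
    qed
    finally have "sum codeg P = codeg {a,b} + codeg {a,c} + codeg {a,d} + codeg {b,c}
        + codeg {b,d} + codeg {c,d}"
      using abcd by (auto simp: doubleton_eq_iff)
    moreover have "s - 1 \<le> codeg {a,b} + codeg {a,c} + codeg {a,d} + codeg {b,c}
        + codeg {b,d} + codeg {c,d}"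
    proof -
      have "s - 1 = (real (card (common {a})) + card (common {b}) + card (common {c})
          + card (common {d}) - card V) / card V"
        using n by (simp add: s deg_def add_divide_distrib diff_divide_distrib)
      also have "\<dots> \<le> (real (card (common {a, b})) + card (common {a, c}) + card (common {a, d})
      + card (common {b, c}) + card (common {b, d}) + card (common {c, d})) / card V"
        by (intro divide_right_mono sum_codegrees_ge) simp
      finally show ?thesis by (simp add: codeg_def add_divide_distrib)
    qed
    ultimately have "s - 1 \<le> sum codeg P" by simp
    then show ?thesis
      using l s_le cost_sum 3 by (simp add: power2_eq_square)
  qed
qed

text \<open>Only the case of fewer cliques than edges is of interest. Then there are at most
  \<open>n^2 / 2\<close> cliques, so heavy edges are few and the codegree part of the total cost is
  bounded.\<close>

lemma edges_minus_cliques4_le: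
  assumes cover: "\<And>f. f \<in> E \<Longrightarrow> \<exists>K\<in>cliques4. f \<subseteq> K"
  shows "real (card E) - card cliques4 \<le> 29/125 * (card V)\<^sup>2 + 200000 * card V + 200"
proof (cases "V = {} \<or> card E \<le> card cliques4")
  case True
  moreover have "E = {}" if "V = {}" using that edges by auto
  moreover have "0 \<le> 29/125 * real ((card V)\<^sup>2) + 200000 * card V + 200" by simp
  ultimately show ?thesis by (elim disjE) (simp, linarith)
next
  case False
  define F where "F = heavy_edges (1/1000)"
  define n where "n = real (card V)"
  have n: "n \<ge> 1" using False finite_V by (auto simp: n_def Suc_le_eq card_gt_0_iff)
  have "card E \<le> card {f. f \<subseteq> V \<and> card f = 2}"
    using finite_V edges by (intro card_mono) auto
  also have "\<dots> = card V choose 2" by (rule card_pairs[OF refl finite_V])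
  finally have "real (card E) \<le> real (card V choose 2)" by simp
  also have "\<dots> \<le> n\<^sup>2 / 2"
    unfolding n_def by (cases "card V") (auto simp: choose_two real_of_nat_div power2_eq_square field_simps)
  finally have "real (card cliques4) \<le> n\<^sup>2 / 2" using False by linarith
  then have Q: "ordered_cliques4 \<le> 128 * n\<^sup>2" using ordered_cliques4_le by linarith
  have F_sub: "F \<subseteq> E" by (auto simp: F_def heavy_edges_def)
  have finF: "finite F" using F_sub finite_E finite_subset by blast
  have F_card: "card F \<le> 128000 * n"
  proof -
    have "1/1000 * n * card F \<le> 128 * n\<^sup>2"
      using card_heavy_edges[of "1/1000"] Q by (simp add: F_def n_def)
    then have "n * card F \<le> n * (128000 * n)" by (simp add: power2_eq_square)
    then show ?thesis using n by (subst (asm) mult_le_cancel_left_pos) auto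
  qed
  obtain \<kappa> where \<kappa>: "\<And>f. f \<in> E \<Longrightarrow> \<kappa> f \<in> cliques4 \<and> f \<subseteq> \<kappa> f"
    using cover by metis
  let ?E1 = "E - F"
  have fin1: "finite ?E1" using finite_E by simp
  \<comment> \<open>Cliques receiving no edge are dropped; one receiving \<open>w\<close> edges then
    contributes \<open>w - 1\<close>.\<close>
  have "real (card ?E1) - card cliques4 \<le> real (card ?E1) - card (\<kappa> ` ?E1)"
    using card_mono[OF finite_cliques4, of "\<kappa> ` ?E1"] \<kappa> by auto
  also have "\<dots> = (\<Sum>K\<in>\<kappa> ` ?E1. real (card {f \<in> ?E1. \<kappa> f = K}) - 1)"
    using sum.image_gen[OF fin1, of "\<lambda>_. 1::real" \<kappa>] by (simp add: sum_subtractf)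
  also have "\<dots> \<le> (\<Sum>K\<in>\<kappa> ` ?E1. sum cost {f \<in> ?E1. \<kappa> f = K})"
  proof (intro sum_mono clique_sum_cost_ge)
    fix K assume "K \<in> \<kappa> ` ?E1"
    then show "K \<in> cliques4" using \<kappa> by auto
    show "{f \<in> ?E1. \<kappa> f = K} \<subseteq> {f. f \<subseteq> K \<and> card f = 2}" using \<kappa> edges by auto
    show "{f \<in> ?E1. \<kappa> f = K} \<inter> heavy_edges (1/1000) = {}" by (auto simp: F_def)
  qed
  also have "\<dots> = sum cost ?E1" by (rule sum.image_gen[OF fin1, symmetric])
  also have "\<dots> = 29/125 * (\<Sum>f\<in>?E1. \<Sum>u\<in>f. 1 / deg u) + (\<Sum>f\<in>?E1. codeg f - 1/3) / 3"
    unfolding cost_def by (simp add: sum.distrib sum_distrib_left sum_divide_distrib)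
  also have "(\<Sum>f\<in>?E1. \<Sum>u\<in>f. 1 / deg u) \<le> (\<Sum>f\<in>E. \<Sum>u\<in>f. 1 / deg u)"
    using finite_E by (intro sum_mono2 sum_nonneg) (auto simp: deg_def)
  also have "(\<Sum>f\<in>E. \<Sum>u\<in>f. 1 / deg u) = (\<Sum>u\<in>V. card (common {u}) * (1 / deg u))"
    unfolding sum_over_edge_ends by simp
  \<comment> \<open>The term is \<open>n\<close>, or 0 at an isolated vertex.\<close>
  also have "\<dots> \<le> (\<Sum>u\<in>V. n)"
    using n by (intro sum_mono) (auto simp: deg_def n_def)
  also have "\<dots> = n\<^sup>2" by (simp add: n_def power2_eq_square)
  also have "(\<Sum>f\<in>?E1. codeg f - 1/3) = (\<Sum>f\<in>E. codeg f - 1/3) - (\<Sum>f\<in>F. codeg f - 1/3)"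
    by (rule sum_diff[OF finite_E F_sub])
  also have "(\<Sum>f\<in>E. codeg f - 1/3) \<le> 128"
  proof -
    have "(\<Sum>f\<in>E. codeg f - 1/3) \<le> ordered_cliques4 / n\<^sup>2"
      using sum_codegree_le False by (simp add: codeg_def n_def)
    also have "\<dots> \<le> 128" using Q n by (simp add: divide_le_eq)
    finally show ?thesis .
  qed
  finally have "real (card ?E1) - card cliques4
      \<le> 29/125 * n\<^sup>2 + (128 - (\<Sum>f\<in>F. codeg f - 1/3)) / 3"
    by simp
  \<comment> \<open>Leaving out a heavy edge raises the codegree sum by at most
    \<open>1/3\<close>.\<close>
  moreover have "(\<Sum>f\<in>F. - (1/3)) \<le> (\<Sum>f\<in>F. codeg f - 1/3)"
    by (intro sum_mono) (simp add: codeg_nonneg)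
  ultimately have "real (card ?E1) - card cliques4 \<le> 29/125 * n\<^sup>2 + 128/3 + card F / 9"
    by (simp add: diff_divide_distrib add_divide_distrib)
  moreover have "real (card ?E1) = real (card E) - card F"
    using card_Diff_subset[OF finF F_sub] card_mono[OF finite_E F_sub] by simp
  ultimately have "real (card E) - card cliques4 \<le> 29/125 * n\<^sup>2 + 200000 * n + 200"
    using F_card n by linarith
  then show ?thesis by (simp add: n_def)
qed

end

section \<open>Antichains\<close>

lemma real_choose_two: "real (n choose 2) = real n * (real n - 1) / 2"
  by (cases n) (auto simp: choose_two real_of_nat_div algebra_simps)

text \<open>A perfect matching, with one path on three vertices if the size is odd. Induction splits
  off a matched pair until 2 or 3 points remain. The last clause says that \<open>M\<close> has no
  triangle.\<close>

lemma ex_triangle_free_edge_cover: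
  assumes "finite X" "card X \<ge> 2"
  shows "\<exists>M \<subseteq> {f. f \<subseteq> X \<and> card f = 2}. card M = (card X + 1) div 2 \<and> \<Union>M = X \<and>
    (\<forall>S. card S = 3 \<longrightarrow> (\<exists>f. f \<subseteq> S \<and> card f = 2 \<and> f \<notin> M))"
  using assms
proof (induction "card X" arbitrary: X rule: less_induct)
  case less
  have small: "\<exists>f. f \<subseteq> S \<and> card f = 2 \<and> f \<notin> M"
    if "card S = 3" "finite M" "card M \<le> 2" for S :: "'a set" and M
  proof (rule ccontr)
    assume "\<not> ?thesis"
    then have "{f. f \<subseteq> S \<and> card f = 2} \<subseteq> M" by blast
    then have "card {f. f \<subseteq> S \<and> card f = 2} \<le> 2"
      using card_mono[OF that(2)] that(3) le_trans by blast
    moreover have "finite S" using that(1) by (simp add: card_ge_0_finite)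
    ultimately show False using card_pairs[OF that(1)] by (simp add: choose_two)
  qed
  consider "card X = 2" | "card X = 3" | "card X \<ge> 4" using less.prems by linarith
  then show ?case
  proof cases
    case 1
    then show ?thesis
      by (intro exI[of _ "{X}"] conjI allI impI small) auto
  next
    case 2
    then obtain a b c where "X = {a, b, c}" "a \<noteq> b" "b \<noteq> c" "a \<noteq> c"
      by (auto simp: card_3_iff)
    then show ?thesis
      by (intro exI[of _ "{{a, b}, {b, c}}"] conjI allI impI small) (auto simp: doubleton_eq_iff)
  next
    case 3
    obtain T where "T \<subseteq> X" "card T = 2"
      using obtain_subset_with_card_n[OF less.prems(2)] by metis
    then obtain x y where x: "x \<in> X" and y: "y \<in> X" "y \<noteq> x" by (auto simp: card_2_iff)
    let ?X = "X - {x, y}"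
    have c: "card ?X = card X - 2" using x y less.prems(1) by (simp add: card_Diff_subset)
    have "card ?X < card X" "finite ?X" "2 \<le> card ?X" using c 3 less.prems(1) by auto
    from less.hyps[OF this]
    obtain M where M: "M \<subseteq> {f. f \<subseteq> ?X \<and> card f = 2}" "card M = (card ?X + 1) div 2"
      "\<Union>M = ?X" "\<And>S. card S = 3 \<Longrightarrow> \<exists>f. f \<subseteq> S \<and> card f = 2 \<and> f \<notin> M"
      by metis
    have finM: "finite M"
      using M(1) less.prems(1) by (auto intro: finite_subset[of M "Pow X"])
    have xM: "{x, z} \<notin> M" for z using M(3) by blast
    \<comment> \<open>If the pair missing from \<open>M\<close> is the new edge
      \<open>{x, y}\<close> itself, the pair of \<open>x\<close> with the third point is still
      missing, as \<open>x\<close> lies in no edge of \<open>M\<close>.\<close>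
    have "\<exists>f. f \<subseteq> S \<and> card f = 2 \<and> f \<notin> insert {x, y} M" if S: "card S = 3" for S
    proof -
      obtain f where f: "f \<subseteq> S" "card f = 2" "f \<notin> M" using M(4)[OF S] by blast
      show ?thesis
      proof (cases "f = {x, y}")
        case True
        have "card (S - {x, y}) = 1"
          using True f(1) S y(2) by (simp add: card_Diff_subset)
        then obtain z where z: "z \<in> S" "z \<noteq> x" "z \<noteq> y" by (auto simp: card_1_singleton_iff)
        then have "{x, z} \<subseteq> S" "card {x, z} = 2" "{x, z} \<notin> insert {x, y} M"
          using True f xM[of z] by (auto simp: doubleton_eq_iff)
        then show ?thesis by blast
      qed (use f in blast)
    qed
    moreover have "card (insert {x, y} M) = (card X + 1) div 2"
      using M(2) c 3 finM xM[of y] by simp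
    moreover have "insert {x, y} M \<subseteq> {f. f \<subseteq> X \<and> card f = 2}"
      using M(1) x y by auto
    moreover have "\<Union>(insert {x, y} M) = X" using M(3) x y by auto
    ultimately show ?thesis by (intro exI[of _ "insert {x, y} M"]) blast
  qed
qed

text \<open>The graph consists of \<open>M\<close>, \<open>N\<close> and all cross pairs;
  \<open>NE\<close> collects its non-edges. Having no triangles, \<open>M\<close> and
  \<open>N\<close> force a 4-clique to be \<open>f \<union> g\<close> with \<open>f\<close> in
  \<open>M\<close> and \<open>g\<close> in \<open>N\<close>; as they cover \<open>X\<close> and
  \<open>Y\<close>, every edge lies in such a clique, which gives maximality. The size is stated
  additively to avoid truncated subtraction.\<close>

lemma ex_maximal_antichain24_join:
  assumes XY: "X \<union> Y = {1..n}" "X \<inter> Y = {}" "X \<noteq> {}" "Y \<noteq> {}"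
    and M: "M \<subseteq> {f. f \<subseteq> X \<and> card f = 2}" "\<Union>M = X"
      "\<And>S. card S = 3 \<Longrightarrow> \<exists>f. f \<subseteq> S \<and> card f = 2 \<and> f \<notin> M"
    and N: "N \<subseteq> {f. f \<subseteq> Y \<and> card f = 2}" "\<Union>N = Y"
      "\<And>S. card S = 3 \<Longrightarrow> \<exists>f. f \<subseteq> S \<and> card f = 2 \<and> f \<notin> N"
  shows "\<exists>\<A>. maximal_antichain24 n \<A> \<and>
    card \<A> + card M + card N \<le> (card X choose 2) + (card Y choose 2) + card M * card N"
proof -
  define PX where "PX = {f. f \<subseteq> X \<and> card f = 2}"
  define PY where "PY = {f. f \<subseteq> Y \<and> card f = 2}"
  define NE where "NE = (PX - M) \<union> (PY - N)"
  define Q where "Q = {K. K \<subseteq> {1..n} \<and> card K = 4 \<and> (\<forall>f. f \<subseteq> K \<and> card f = 2 \<longrightarrow> f \<notin> NE)}"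
  have "finite (X \<union> Y)" unfolding XY(1) by simp
  then have fin: "finite X" "finite Y" by auto
  have finP: "finite PX" "finite PY" using fin by (auto simp: PX_def PY_def)
  have MP: "M \<subseteq> PX" "N \<subseteq> PY" using M N by (auto simp: PX_def PY_def)
  have finMN: "finite M" "finite N" using MP finP finite_subset by blast+
  have NE2: "f \<subseteq> {1..n}" "card f = 2" if "f \<in> NE" for f
    using that XY(1) by (auto simp: NE_def PX_def PY_def)
  have union_in_Q: "f \<union> g \<in> Q" if "f \<in> M" "g \<in> N" for f g
  proof -
    have f: "f \<subseteq> X" "card f = 2" and g: "g \<subseteq> Y" "card g = 2" using that M N by auto
    have fin_fg: "finite f" "finite g" using f g fin finite_subset by blast+
    have "card (f \<union> g) = 4" using f g fin_fg XY(2) by (subst card_Un_disjoint) auto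
    moreover have "f \<union> g \<subseteq> {1..n}" using f g XY(1) by blast
    moreover have "h \<notin> NE" if h: "h \<subseteq> f \<union> g" "card h = 2" for h
    proof
      assume "h \<in> NE"
      then consider "h \<subseteq> X" "h \<notin> M" | "h \<subseteq> Y" "h \<notin> N" by (auto simp: NE_def PX_def PY_def)
      then show False
      proof cases
        case 1
        then have "h \<subseteq> f" using h g(1) XY(2) by blast
        then have "h = f" using card_subset_eq[OF fin_fg(1)] h f by simp
        then show False using 1 \<open>f \<in> M\<close> by simp
      next
        case 2
        then have "h \<subseteq> g" using h f(1) XY(2) by blast
        then have "h = g" using card_subset_eq[OF fin_fg(2)] h g by simp
        then show False using 2 \<open>g \<in> N\<close> by simp
      qed
    qed
    ultimately show ?thesis by (auto simp: Q_def)
  qed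
  have Q_sub: "Q \<subseteq> (\<lambda>(f, g). f \<union> g) ` (M \<times> N)"
  proof
    fix K assume K: "K \<in> Q"
    then have K4: "K \<subseteq> X \<union> Y" "card K = 4" and KNE: "\<And>f. f \<subseteq> K \<Longrightarrow> card f = 2 \<Longrightarrow> f \<notin> NE"
      unfolding Q_def XY(1) by blast+
    \<comment> \<open>Three points of \<open>K\<close> on one side would contain a non-edge.\<close>
    have small: "card (K \<inter> Z) \<le> 2"
      if free: "\<And>S. card S = 3 \<Longrightarrow> \<exists>f. f \<subseteq> S \<and> card f = 2 \<and> f \<notin> L"
        and sub: "{f. f \<subseteq> Z \<and> card f = 2} - L \<subseteq> NE" for Z L
    proof (rule ccontr)
      assume "\<not> ?thesis"
      then have "3 \<le> card (K \<inter> Z)" by simp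
      then obtain S where S: "S \<subseteq> K \<inter> Z" "card S = 3" by (rule obtain_subset_with_card_n)
      then obtain f where "f \<subseteq> S" "card f = 2" "f \<notin> L" using free by blast
      then have "f \<in> NE" "f \<subseteq> K" using S sub by blast+
      then show False using KNE \<open>card f = 2\<close> by blast
    qed
    have "card (K \<inter> X) \<le> 2" by (rule small[OF M(3)]) (auto simp: NE_def PX_def)
    moreover have "card (K \<inter> Y) \<le> 2" by (rule small[OF N(3)]) (auto simp: NE_def PY_def)
    moreover have "card K = card (K \<inter> X) + card (K \<inter> Y)"
    proof -
      have "K = (K \<inter> X) \<union> (K \<inter> Y)" using K4(1) by blast
      then have "card K = card ((K \<inter> X) \<union> (K \<inter> Y))" by simp
      also have "\<dots> = card (K \<inter> X) + card (K \<inter> Y)"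
        using fin XY(2) by (intro card_Un_disjoint) auto
      finally show ?thesis .
    qed
    ultimately have two: "card (K \<inter> X) = 2" "card (K \<inter> Y) = 2" using K4(2) by linarith+
    have "K \<inter> X \<in> M" "K \<inter> Y \<in> N"
      using KNE[of "K \<inter> X"] KNE[of "K \<inter> Y"] two by (auto simp: NE_def PX_def PY_def)
    moreover have "K = (K \<inter> X) \<union> (K \<inter> Y)" using K4(1) by blast
    ultimately show "K \<in> (\<lambda>(f, g). f \<union> g) ` (M \<times> N)"
      by (intro image_eqI[of _ _ "(K \<inter> X, K \<inter> Y)"]) auto
  qed
  have ac: "antichain24 n (NE \<union> Q)"
    unfolding antichain24_def antichain_on_def
  proof (intro conjI ballI impI)
    show "NE \<union> Q \<subseteq> Pow {1..n}" using NE2 by (auto simp: Q_def)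
    fix A assume A: "A \<in> NE \<union> Q"
    then show "card A \<in> {2, 4}" using NE2 by (auto simp: Q_def)
    fix B assume B: "B \<in> NE \<union> Q" and "A \<noteq> B"
    have card24: "card C = 2 \<and> C \<in> NE \<or> card C = 4 \<and> C \<in> Q" "finite C" if "C \<in> NE \<union> Q" for C
      using that NE2[of C] by (auto simp: Q_def intro: card_ge_0_finite)
    show "\<not> A \<subseteq> B"
    proof
      assume AB: "A \<subseteq> B"
      then have "card A \<noteq> card B" using card_subset_eq[OF card24(2)[OF B]] \<open>A \<noteq> B\<close> by blast
      moreover have "card A \<le> card B" using card_mono[OF card24(2)[OF B] AB] .
      ultimately have "card A = 2" "A \<in> NE" "B \<in> Q" using card24(1)[OF A] card24(1)[OF B] by auto
      then show False using AB by (auto simp: Q_def)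
    qed
  qed
  have "\<not> (\<exists>\<A>'. antichain24 n \<A>' \<and> NE \<union> Q \<subset> \<A>')"
  proof
    assume "\<exists>\<A>'. antichain24 n \<A>' \<and> NE \<union> Q \<subset> \<A>'"
    then obtain \<A>' B where A': "antichain24 n \<A>'" "NE \<union> Q \<subseteq> \<A>'" "B \<in> \<A>'" "B \<notin> NE \<union> Q"
      by blast
    have B: "B \<subseteq> {1..n}" "card B = 2 \<or> card B = 4"
      and anti: "\<And>C D. C \<in> \<A>' \<Longrightarrow> D \<in> \<A>' \<Longrightarrow> C \<subseteq> D \<Longrightarrow> C = D"
      using A' unfolding antichain24_def antichain_on_def by auto
    from B(2) show False
    proof
      assume "card B = 4"
      then obtain f where "f \<subseteq> B" "f \<in> NE" using A'(4) B by (auto simp: Q_def)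
      then show False using anti[of f B] A' by blast
    next
      assume B2: "card B = 2"
      obtain u v where uv: "B = {u, v}" "u \<noteq> v" using B2 by (auto simp: card_2_iff)
      have uvXY: "u \<in> X \<union> Y" "v \<in> X \<union> Y" using uv B(1) unfolding XY(1) by auto
      \<comment> \<open>A pair outside \<open>NE\<close> is an edge of the graph, so some clique in
        \<open>Q\<close> contains it.\<close>
      have "\<exists>f\<in>M. \<exists>g\<in>N. B \<subseteq> f \<union> g"
      proof -
        have BM: "B \<in> M" if "B \<subseteq> X" using A'(4) that B2 by (auto simp: NE_def PX_def)
        have BN: "B \<in> N" if "B \<subseteq> Y" using A'(4) that B2 by (auto simp: NE_def PY_def)
        consider "B \<subseteq> X" | "B \<subseteq> Y" | "\<exists>x\<in>X. \<exists>y\<in>Y. B = {x, y}"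
          using uv uvXY by (auto simp: insert_commute)
        then show ?thesis
        proof cases
          case 1
          then show ?thesis using BM N(2) XY(4) by blast
        next
          case 2
          then show ?thesis using BN M(2) XY(3) by blast
        next
          case 3
          then obtain x y where "x \<in> X" "y \<in> Y" "B = {x, y}" by blast
          moreover obtain f where "f \<in> M" "x \<in> f" using M(2) \<open>x \<in> X\<close> by blast
          moreover obtain g where "g \<in> N" "y \<in> g" using N(2) \<open>y \<in> Y\<close> by blast
          ultimately show ?thesis by blast
        qed
      qed
      then obtain f g where "f \<in> M" "g \<in> N" "B \<subseteq> f \<union> g" by blast
      then show False using anti[of B "f \<union> g"] union_in_Q[of f g] A' by blast
    qed
  qed
  then have "maximal_antichain24 n (NE \<union> Q)" using ac by (simp add: maximal_antichain24_def)
  moreover have "card (NE \<union> Q) + card M + card N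
      \<le> (card X choose 2) + (card Y choose 2) + card M * card N"
  proof -
    have "card (NE \<union> Q) \<le> card (PX - M) + card (PY - N) + card Q"
      unfolding NE_def by (meson card_Un_le add_le_mono order_refl order_trans)
    moreover have "card Q \<le> card M * card N"
      using surj_card_le[OF _ Q_sub] finMN by (simp add: card_cartesian_product)
    moreover have "card (PX - M) = card PX - card M" "card (PY - N) = card PY - card N"
      using MP finMN by (simp_all add: card_Diff_subset)
    moreover have "card M \<le> card PX" "card N \<le> card PY" using MP finP by (simp_all add: card_mono)
    moreover have "card PX = card X choose 2" "card PY = card Y choose 2"
      using fin by (simp_all add: PX_def PY_def card_pairs)
    ultimately show ?thesis by linarith
  qed
  ultimately show ?thesis by blast
qed

text \<open>Compares with the join on parts of sizes \<open>a\<close> and \<open>b\<close>, using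
  \<open>p * q - p - q = (p - 1) * (q - 1) - 1\<close>.\<close>

lemma minimum_maximal_antichain24_card_le:
  assumes min: "minimum_maximal_antichain24 (a + b) \<A>" and ab: "a \<ge> 2" "b \<ge> 2"
    and p: "p = (a + 1) div 2" and q: "q = (b + 1) div 2"
  shows "real (card \<A>) \<le> real a * (real a - 1) / 2 + real b * (real b - 1) / 2
    + (real p - 1) * (real q - 1) - 1"
proof -
  let ?X = "{1..a}" and ?Y = "{a+1..a+b}"
  obtain M where M: "M \<subseteq> {f. f \<subseteq> ?X \<and> card f = 2}" "card M = p" "\<Union>M = ?X"
    "\<And>S. card S = 3 \<Longrightarrow> \<exists>f. f \<subseteq> S \<and> card f = 2 \<and> f \<notin> M"
    using ex_triangle_free_edge_cover[of ?X] ab p by auto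
  obtain N where N: "N \<subseteq> {f. f \<subseteq> ?Y \<and> card f = 2}" "card N = q" "\<Union>N = ?Y"
    "\<And>S. card S = 3 \<Longrightarrow> \<exists>f. f \<subseteq> S \<and> card f = 2 \<and> f \<notin> N"
    using ex_triangle_free_edge_cover[of ?Y] ab q by auto
  have "?X \<union> ?Y = {1..a+b}" "?X \<inter> ?Y = {}" "?X \<noteq> {}" "?Y \<noteq> {}" using ab by auto
  then obtain \<B> where B: "maximal_antichain24 (a + b) \<B>"
    "card \<B> + card M + card N \<le> (card ?X choose 2) + (card ?Y choose 2) + card M * card N"
    using ex_maximal_antichain24_join[OF _ _ _ _ M(1,3,4) N(1,3,4)] by blast
  have "card \<A> \<le> card \<B>"
    using min B(1) unfolding minimum_maximal_antichain24_def is_arg_min_def by (meson not_le)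
  then have "real (card \<A> + p + q) \<le> real ((a choose 2) + (b choose 2) + p * q)"
    using B(2) M(2) N(2) by (subst of_nat_le_iff) simp
  then show ?thesis by (simp add: real_choose_two algebra_simps)
qed

text \<open>One split for each residue of \<open>n\<close> modulo 4; the resulting counts equal the
  rounded expressions.\<close>

lemma minimum_maximal_antichain24_upper:
  assumes min: "minimum_maximal_antichain24 n \<A>" and n: "n \<ge> 4"
  shows "int (card \<A>) \<le>
         (if even n then \<lceil>(5 * (real n)\<^sup>2 - 16 * real n) / 16\<rceil>
          else \<lfloor>(5 * (real n)\<^sup>2 - 14 * real n) / 16\<rfloor>)"
proof -
  define k where "k = n div 4"
  have k: "k \<ge> 1" using n by (simp add: k_def)
  consider "n = 4 * k" | "n = 4 * k + 1" | "n = 4 * k + 2" | "n = 4 * k + 3"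
    unfolding k_def by linarith
  then show ?thesis
  proof cases
    case 1
    then have "n = 2 * k + 2 * k" by simp
    from minimum_maximal_antichain24_card_le[OF min[unfolded this] _ _ refl refl] k
    have "real (card \<A>) \<le> 5 * (real k)\<^sup>2 - 4 * real k"
      by (simp add: power2_eq_square algebra_simps add_divide_distrib diff_divide_distrib)
    then show ?thesis using 1 by (simp add: le_ceiling_iff power2_eq_square field_simps)
  next
    case 2
    then have "n = 2 * k + (2 * k + 1)" by simp
    from minimum_maximal_antichain24_card_le[OF min[unfolded this] _ _ refl refl] k
    have "real (card \<A>) \<le> 5 * (real k)\<^sup>2 - real k - 1"
      by (simp add: power2_eq_square algebra_simps add_divide_distrib diff_divide_distrib)
    then show ?thesis using 2 by (simp add: le_floor_iff power2_eq_square field_simps)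
  next
    case 3
    \<comment> \<open>Unequal even parts allow perfect matchings on both sides, whereas two parts of
      size \<open>2 * k + 1\<close> would give \<open>5 * k^2 + 2 * k - 1\<close>.\<close>
    then have "n = 2 * k + (2 * k + 2)" by simp
    from minimum_maximal_antichain24_card_le[OF min[unfolded this] _ _ refl refl] k
    have "real (card \<A>) \<le> 5 * (real k)\<^sup>2 + real k"
      by (simp add: power2_eq_square algebra_simps add_divide_distrib diff_divide_distrib)
    then show ?thesis using 3 by (simp add: le_ceiling_iff power2_eq_square field_simps)
  next
    case 4
    then have "n = (2 * k + 2) + (2 * k + 1)" by simp
    from minimum_maximal_antichain24_card_le[OF min[unfolded this] _ _ refl refl] k
    have "real (card \<A>) \<le> 5 * (real k)\<^sup>2 + 4 * real k"
      by (simp add: power2_eq_square algebra_simps add_divide_distrib diff_divide_distrib)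
    then show ?thesis using 4 by (simp add: le_floor_iff power2_eq_square field_simps)
  qed
qed

section \<open>The lower bound: from antichains to graphs, with
  \<open>67/250 = 1/2 - 29/125\<close>\<close>

lemma maximal_antichain24_lower:
  assumes max: "maximal_antichain24 n \<A>"
  shows "67/250 * (real n)\<^sup>2 - 200001 * real n - 200 \<le> card \<A>"
proof -
  define V where "V = {1..n}"
  define P where "P = {f. f \<subseteq> V \<and> card f = 2}"
  define E where "E = P - \<A>"
  interpret finite_graph V E
    by unfold_locales (auto simp: V_def E_def P_def)
  have ac: "antichain24 n \<A>" and no_ext: "\<And>B. antichain24 n (insert B \<A>) \<Longrightarrow> B \<in> \<A>"
    using max unfolding maximal_antichain24_def by blast+
  have A: "B \<subseteq> V" "card B = 2 \<or> card B = 4" "finite B" if "B \<in> \<A>" for B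
  proof -
    show "B \<subseteq> V" "card B = 2 \<or> card B = 4"
      using ac that unfolding antichain24_def antichain_on_def V_def by auto
    then show "finite B" using finite_V finite_subset by blast
  qed
  have anti: "C = D" if "C \<in> \<A>" "D \<in> \<A>" "C \<subseteq> D" for C D
    using ac that unfolding antichain24_def antichain_on_def by blast
  have finA: "finite \<A>" using A(1) finite_V by (intro finite_subset[of \<A> "Pow V"]) auto
  have extend: "\<exists>C\<in>\<A>. C \<subseteq> B \<or> B \<subseteq> C" if B: "B \<subseteq> V" "card B = 2 \<or> card B = 4" for B
  proof (rule ccontr)
    assume neg: "\<not> ?thesis"
    then have "antichain24 n (insert B \<A>)"
      using ac B unfolding antichain24_def antichain_on_def V_def by auto
    then show False using no_ext neg by blast
  qed
  \<comment> \<open>By maximality a clique is comparable to some member of the antichain; no pair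
    inside it is a member, so that member is the clique itself.\<close>
  have cliques: "cliques4 \<subseteq> \<A>"
  proof
    fix K assume "K \<in> cliques4"
    then have K: "K \<subseteq> V" "card K = 4" "\<And>f. f \<subseteq> K \<Longrightarrow> card f = 2 \<Longrightarrow> f \<notin> \<A>"
      unfolding cliques4_def by (auto simp: E_def)
    obtain C where C: "C \<in> \<A>" "C \<subseteq> K \<or> K \<subseteq> C" using extend[of K] K by blast
    have "finite K" using K(2) by (simp add: card_ge_0_finite)
    from C(2) have "C = K"
    proof
      assume CK: "C \<subseteq> K"
      then have "card C = 4" using A(2)[OF C(1)] K(3) C(1) by blast
      then show ?thesis using card_subset_eq[OF \<open>finite K\<close> CK] K(2) by simp
    next
      assume KC: "K \<subseteq> C"
      then have "card C = 4" using card_mono[OF A(3)[OF C(1)] KC] A(2)[OF C(1)] K(2) by simp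
      then show ?thesis using card_subset_eq[OF A(3)[OF C(1)] KC] K(2) by simp
    qed
    then show "K \<in> \<A>" using C(1) by simp
  qed
  \<comment> \<open>A pair missing from the antichain lies in some 4-set of it, all of whose pairs
    are then missing too.\<close>
  have cover: "\<exists>K\<in>cliques4. f \<subseteq> K" if f: "f \<in> E" for f
  proof -
    have f2: "f \<subseteq> V" "card f = 2" "f \<notin> \<A>" using f by (auto simp: E_def P_def)
    obtain C where C: "C \<in> \<A>" "C \<subseteq> f \<or> f \<subseteq> C" using extend[of f] f2 by blast
    have finf: "finite f" using f2(2) by (simp add: card_ge_0_finite)
    have "\<not> C \<subseteq> f"
    proof
      assume Cf: "C \<subseteq> f"
      then have "card C = card f" using card_mono[OF finf Cf] f2(2) A(2)[OF C(1)] by linarith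
      then show False using card_subset_eq[OF finf Cf] C(1) f2(3) by simp
    qed
    then have fC: "f \<subseteq> C" using C(2) by blast
    have "card C = 4"
      using A(2)[OF C(1)] card_subset_eq[OF A(3)[OF C(1)] fC] f2 C(1) by auto
    moreover have "h \<in> E" if "h \<subseteq> C" "card h = 2" for h
      using that anti[of h C] C(1) A(1)[OF C(1)] \<open>card C = 4\<close> by (auto simp: E_def P_def)
    ultimately have "C \<in> cliques4" using A(1)[OF C(1)] by (auto simp: cliques4_def)
    then show ?thesis using fC by blast
  qed
  have finP: "finite P" using finite_V by (auto simp: P_def)
  have EP: "E \<subseteq> P" by (auto simp: E_def)
  have "card (P - E) + card cliques4 = card ((P - E) \<union> cliques4)"
    using finP finite_cliques4 by (intro card_Un_disjoint[symmetric]) (auto simp: P_def cliques4_def)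
  also have "\<dots> \<le> card \<A>"
    using finA cliques by (intro card_mono) (auto simp: E_def)
  finally have "card (P - E) + card cliques4 \<le> card \<A>" .
  moreover have "card (P - E) = card P - card E" "card E \<le> card P"
    using finP finite_E EP by (simp_all add: card_Diff_subset card_mono)
  moreover have "card P = n choose 2" unfolding P_def by (rule card_pairs) (simp_all add: V_def)
  ultimately have "real (n choose 2) - card E + card cliques4 \<le> card \<A>" by linarith
  moreover have "real (card E) - card cliques4 \<le> 29/125 * (real n)\<^sup>2 + 200000 * n + 200"
    using edges_minus_cliques4_le[OF cover] by (simp add: V_def)
  moreover have "real (n choose 2) = (real n)\<^sup>2 / 2 - real n / 2"
    by (simp add: real_choose_two power2_eq_square algebra_simps diff_divide_distrib)
  ultimately show ?thesis by simp
qed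

theorem corollary13:
  shows "\<exists>\<epsilon> :: nat \<Rightarrow> real. \<epsilon> \<longlonglongrightarrow> 0 \<and>
    (\<forall>n \<ge> 4. \<forall>\<A>. minimum_maximal_antichain24 n \<A> \<longrightarrow>
       ((219 - 4 * sqrt 21) / 750 + \<epsilon> n) * (real n)\<^sup>2 \<le> real (card \<A>) \<and>
       int (card \<A>) \<le>
         (if even n then \<lceil>(5 * (real n)\<^sup>2 - 16 * real n) / 16\<rceil>
          else \<lfloor>(5 * (real n)\<^sup>2 - 14 * real n) / 16\<rfloor>))"
proof (intro exI conjI allI impI)
  \<comment> \<open>The value \<open>-1\<close> makes the lower bound nonpositive for small
    \<open>n\<close>. From \<open>10^9\<close> on, the gap \<open>0.268 - 0.2676\<close> times
    \<open>n^2\<close> is at least \<open>400000 * n\<close>, which absorbs the lower-order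
    terms.\<close>
  let ?\<epsilon> = "\<lambda>n::nat. if n < 10^9 then - 1 else 0 :: real"
  show "?\<epsilon> \<longlonglongrightarrow> 0"
    by (rule tendsto_eventually, rule eventually_sequentiallyI[of "10^9"]) simp
  fix n :: nat and \<A>
  assume n: "n \<ge> 4" and min: "minimum_maximal_antichain24 n \<A>"
  show "int (card \<A>) \<le>
         (if even n then \<lceil>(5 * (real n)\<^sup>2 - 16 * real n) / 16\<rceil>
          else \<lfloor>(5 * (real n)\<^sup>2 - 14 * real n) / 16\<rfloor>)"
    using minimum_maximal_antichain24_upper[OF min n] .
  have "maximal_antichain24 n \<A>"
    using min by (simp add: minimum_maximal_antichain24_def is_arg_min_def)
  note lower = maximal_antichain24_lower[OF this]
  have "sqrt 21 \<ge> 458/100" by (rule real_le_rsqrt) (simp add: power2_eq_square)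
  then have const: "(219 - 4 * sqrt 21) / 750 \<le> 2676/10000" by simp
  show "((219 - 4 * sqrt 21) / 750 + ?\<epsilon> n) * (real n)\<^sup>2 \<le> real (card \<A>)"
  proof (cases "n < 10^9")
    case True
    then have "((219 - 4 * sqrt 21) / 750 + ?\<epsilon> n) * (real n)\<^sup>2 \<le> 0"
      using const by (intro mult_nonpos_nonneg) auto
    then show ?thesis by linarith
  next
    case False
    then have N: "real n \<ge> 1000000000" by simp
    have "((219 - 4 * sqrt 21) / 750 + ?\<epsilon> n) * (real n)\<^sup>2 \<le> 2676/10000 * (real n)\<^sup>2"
      using const False by (intro mult_right_mono) auto
    moreover have "1000000000 * real n \<le> (real n)\<^sup>2"
      unfolding power2_eq_square using N by (intro mult_right_mono) auto
    ultimately show ?thesis using lower N by linarith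
  qed
qed

end
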